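(* (a) Let $A\in\mathcal{M}_n(\mathbb{C})$ and $\alpha,\beta\in\mathbb{R}$. The image of a line segment $\epsilon_A\subseteq NR[A]$ by the Levinger transformation, i.e. under the induced map $x+\mathbf{i}y\mapsto\alpha x+\mathbf{i}\beta y$ ($x,y\in\mathbb{R}$) from $NR[A]$ onto $NR[\mathcal{L}(A,\alpha,\beta)]$, is a line segment $\epsilon_{\mathcal{L}}\subseteq NR[\mathcal{L}(A,\alpha,\beta)]$. (b) If $A\in\mathcal{M}_n(\mathbb{R})$ and $NR[A]$ is an ellipse, then $NR[\mathcal{L}(A,\alpha,\beta)]$, for $\alpha\neq0$, is also an ellipse.
   Context: $\mathcal{M}_n(\mathbb{C})$, $\mathcal{M}_n(\mathbb{R})$ are the algebras of $n\times n$ complex, real matrices. The numerical range of a matrix $A$ is $NR[A]=\{x^*Ax:\ x\in\mathbb{C}^n,\ x^*x=1\}$. For $\alpha,\beta\in\mathbb{R}$ the generalized Levinger transformation of $A$ is $\mathcal{L}(A,\alpha,\beta)=\alpha H_A+\beta S_A=\frac{\alpha+\beta}{2}A+\frac{\alpha-\beta}{2}A^*$, where $H_A=\frac{A+A^*}{2}$, $S_A=\frac{A-A^*}{2}$. Saying that a numerical range is an ellipse refers to the closed region bounded by the ellipse.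
   Formalization: In (b) a proper ellipse is shown to stay proper only for β≠0; at β=0 the range is real, so it is only a degenerate ellipse (segment or point), as for A=[[0,1],[0,0]]. In (a) the image segment may be a point when α or β is 0. *)

theory Defs
  imports "HOL-Analysis.Analysis"
begin

definition cinner :: "complex^'n \<Rightarrow> complex^'n \<Rightarrow> complex" where
  "cinner x y = (\<Sum>i\<in>UNIV. cnj (x $ i) * y $ i)"

definition cadjoint :: "complex^'n^'n \<Rightarrow> complex^'n^'n" where
  "cadjoint A = (\<chi> i j. cnj (A $ j $ i))"

definition numerical_range :: "complex^'n^'n \<Rightarrow> complex set" where
  "numerical_range A = {cinner x (A *v x) | x. cinner x x = 1}"

definition hermitian_part :: "complex^'n^'n \<Rightarrow> complex^'n^'n" where
  "hermitian_part A = (1/2) *\<^sub>R (A + cadjoint A)"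

definition skew_hermitian_part :: "complex^'n^'n \<Rightarrow> complex^'n^'n" where
  "skew_hermitian_part A = (1/2) *\<^sub>R (A - cadjoint A)"

definition levinger :: "complex^'n^'n \<Rightarrow> real \<Rightarrow> real \<Rightarrow> complex^'n^'n" where
  "levinger A \<alpha> \<beta> = \<alpha> *\<^sub>R hermitian_part A + \<beta> *\<^sub>R skew_hermitian_part A"

lemma levinger_altdef:
  "levinger A \<alpha> \<beta> = ((\<alpha> + \<beta>) / 2) *\<^sub>R A + ((\<alpha> - \<beta>) / 2) *\<^sub>R cadjoint A"
  by (simp add: levinger_def hermitian_part_def skew_hermitian_part_def vec_eq_iff)
     (simp add: scaleR_conv_of_real field_simps)

definition levinger_map :: "real \<Rightarrow> real \<Rightarrow> complex \<Rightarrow> complex" where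
  "levinger_map \<alpha> \<beta> z = Complex (\<alpha> * Re z) (\<beta> * Im z)"

text \<open>
  The closed region bounded by the ellipse with centre \<open>c\<close> and semi-axes \<open>a\<close>, \<open>b\<close>, the first
  making the angle \<open>\<theta>\<close> with the real axis. Parametrising by the unit disc rather than
  dividing by the semi-axes keeps the definition meaningful when one of them is 0.
\<close>

definition elliptical_disc :: "complex \<Rightarrow> real \<Rightarrow> real \<Rightarrow> real \<Rightarrow> complex set" where
  "elliptical_disc c \<theta> a b =
     {c + cis \<theta> * Complex (a * x) (b * y) | x y. x\<^sup>2 + y\<^sup>2 \<le> 1}"

definition is_ellipse :: "complex set \<Rightarrow> bool" where
  "is_ellipse S \<longleftrightarrow> (\<exists>c \<theta> a b. a > 0 \<and> b > 0 \<and> S = elliptical_disc c \<theta> a b)"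

text \<open>
  Allowing zero semi-axes adds exactly the closed line segments and the single points. These
  are unavoidable as numerical ranges of Levinger transforms: for \<open>\<beta> = 0\<close> the matrix
  \<open>levinger A \<alpha> \<beta>\<close> is Hermitian, so its numerical range lies on the real axis.
\<close>

definition is_possibly_degenerate_ellipse :: "complex set \<Rightarrow> bool" where
  "is_possibly_degenerate_ellipse S \<longleftrightarrow>
     (\<exists>c \<theta> a b. a \<ge> 0 \<and> b \<ge> 0 \<and> S = elliptical_disc c \<theta> a b)"

end

theory Submission
  imports Defs
begin

text \<open>
  Since \<open>x\<^sup>* A\<^sup>* x\<close> is the conjugate of \<open>x\<^sup>* A x\<close>, the number \<open>x\<^sup>* \<L>(A,\<alpha>,\<beta>) x\<close> depends only on
  \<open>z = x\<^sup>* A x\<close>: it is \<open>s z + d z\<^sup>*\<close> with \<open>s = (\<alpha> + \<beta>)/2\<close> and \<open>d = (\<alpha> - \<beta>)/2\<close>, which is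
  \<open>levinger_map \<alpha> \<beta> z\<close>. So the numerical range of the transformed matrix is the image of the
  original one under a real-linear map of the plane (lemma \<open>numerical_range_levinger\<close>), and
  everything reduces to plane geometry.

  Real-linear maps send segments to segments. For ellipses, write every real-affine map of the
  plane as \<open>z \<mapsto> c + p z + q z\<^sup>*\<close>. The elliptical discs are exactly the images of the closed unit
  disc under such maps: one inclusion is the definition (lemma \<open>elliptical_disc_eq_image\<close>), the
  other is the singular value decomposition, which gives the semi-axes \<open>\<bar>p\<bar> + \<bar>q\<bar>\<close> and
  \<open>\<bar>\<bar>p\<bar> - \<bar>q\<bar>\<bar>\<close> (lemma \<open>image_unit_disc_is_elliptical_disc\<close>). Real-affine maps are closed under
  composition, so the image of an ellipse is an ellipse. It is non-degenerate as long as
  \<open>\<bar>p\<bar> \<noteq> \<bar>q\<bar>\<close>, and \<open>\<bar>p\<bar>\<^sup>2 - \<bar>q\<bar>\<^sup>2\<close>, the determinant of the linear part, is multiplied by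
  \<open>\<alpha> \<beta>\<close> under the Levinger map.
\<close>

section \<open>The numerical range of the Levinger transform\<close>

lemma levinger_map_eq:
  "levinger_map \<alpha> \<beta> z =
     complex_of_real ((\<alpha> + \<beta>) / 2) * z + complex_of_real ((\<alpha> - \<beta>) / 2) * cnj z"
  by (simp add: levinger_map_def complex_eq_iff field_simps)

lemma linear_levinger_map: "linear (levinger_map \<alpha> \<beta>)"
  by (rule linearI) (simp_all add: levinger_map_def complex_eq_iff algebra_simps)

lemma cinner_cadjoint: "cinner x (cadjoint A *v x) = cnj (cinner x (A *v x))"
proof -
  have "cinner x (cadjoint A *v x) =
      (\<Sum>i\<in>UNIV. \<Sum>j\<in>UNIV. cnj (x $ i) * (cnj (A $ j $ i) * x $ j))"
    by (simp add: cinner_def cadjoint_def matrix_vector_mult_def sum_distrib_left)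
  also have "\<dots> = (\<Sum>j\<in>UNIV. \<Sum>i\<in>UNIV. cnj (x $ i) * (cnj (A $ j $ i) * x $ j))"
    by (rule sum.swap)
  also have "\<dots> = cnj (cinner x (A *v x))"
    by (simp add: cinner_def matrix_vector_mult_def sum_distrib_left ac_simps)
  finally show ?thesis .
qed

lemma cinner_levinger:
  "cinner x (levinger A \<alpha> \<beta> *v x) = levinger_map \<alpha> \<beta> (cinner x (A *v x))"
proof -
  have "cinner x (levinger A \<alpha> \<beta> *v x) =
      complex_of_real ((\<alpha> + \<beta>) / 2) * cinner x (A *v x) +
      complex_of_real ((\<alpha> - \<beta>) / 2) * cinner x (cadjoint A *v x)"
    unfolding levinger_altdef cinner_def matrix_vector_mult_def
    by (simp add: scaleR_conv_of_real[where 'a=complex] algebra_simps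
        sum.distrib sum_distrib_left sum_subtractf)
  then show ?thesis
    by (simp only: cinner_cadjoint levinger_map_eq)
qed

lemma numerical_range_levinger:
  "numerical_range (levinger A \<alpha> \<beta>) = levinger_map \<alpha> \<beta> ` numerical_range A"
  unfolding numerical_range_def cinner_levinger by blast

section \<open>Elliptical discs as affine images of the unit disc\<close>

lemma elliptical_disc_eq_image:
  "elliptical_disc c \<theta> a b =
     (\<lambda>z. c + cis \<theta> * complex_of_real ((a + b) / 2) * z
            + cis \<theta> * complex_of_real ((a - b) / 2) * cnj z) ` cball 0 1"
proof -
  have param: "c + cis \<theta> * Complex (a * x) (b * y) =
      c + cis \<theta> * complex_of_real ((a + b) / 2) * Complex x y
        + cis \<theta> * complex_of_real ((a - b) / 2) * cnj (Complex x y)" for x y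
  proof -
    have "Complex (a * x) (b * y) =
        complex_of_real ((a + b) / 2) * Complex x y
        + complex_of_real ((a - b) / 2) * cnj (Complex x y)"
      by (simp add: complex_eq_iff field_simps)
    then show ?thesis by (simp only: distrib_left mult.assoc add.assoc)
  qed
  have "z \<in> cball 0 1 \<longleftrightarrow> (\<exists>x y. z = Complex x y \<and> x\<^sup>2 + y\<^sup>2 \<le> 1)" for z
    by (cases z) (simp add: complex_norm)
  then have disc: "cball 0 1 = {Complex x y | x y. x\<^sup>2 + y\<^sup>2 \<le> 1}"
    by blast
  show ?thesis
    unfolding elliptical_disc_def param disc by blast
qed

text \<open>
  The orientation of the second semi-axis is invisible, because the unit disc is symmetric under
  conjugation.
\<close>

lemma elliptical_disc_abs: "elliptical_disc c \<theta> a \<bar>b\<bar> = elliptical_disc c \<theta> a b"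
proof (cases "b \<ge> 0")
  case False
  have reflect: "elliptical_disc c \<theta> a (- b') \<subseteq> elliptical_disc c \<theta> a b'" for b'
  proof
    fix w
    assume "w \<in> elliptical_disc c \<theta> a (- b')"
    then obtain x y where "w = c + cis \<theta> * Complex (a * x) (b' * (- y))" "x\<^sup>2 + (- y)\<^sup>2 \<le> 1"
      unfolding elliptical_disc_def by auto
    then show "w \<in> elliptical_disc c \<theta> a b'"
      unfolding elliptical_disc_def by blast
  qed
  from reflect[of b] reflect[of "- b"] False show ?thesis by simp
qed simp

text \<open>
  The singular value decomposition in the plane. Writing \<open>p = \<bar>p\<bar> e\<^bsup>is\<^esup>\<close>, \<open>q = \<bar>q\<bar> e\<^bsup>it\<^esup>\<close> and
  substituting \<open>w = e\<^bsup>i(s-t)/2\<^esup> z\<close>, which permutes the unit disc, gives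
  \<open>p z + q z\<^sup>* = e\<^bsup>i(s+t)/2\<^esup> (\<bar>p\<bar> w + \<bar>q\<bar> w\<^sup>*)\<close>; the bracket scales the two coordinates of
  \<open>w\<close> by \<open>\<bar>p\<bar> + \<bar>q\<bar>\<close> and \<open>\<bar>p\<bar> - \<bar>q\<bar>\<close>.
\<close>

lemma image_unit_disc_is_elliptical_disc:
  "(\<lambda>z. c + p * z + q * cnj z) ` cball 0 1 =
     elliptical_disc c ((Arg p + Arg q) / 2) (cmod p + cmod q) \<bar>cmod p - cmod q\<bar>"
proof -
  define \<theta> where "\<theta> = (Arg p + Arg q) / 2"
  define \<phi> where "\<phi> = (Arg p - Arg q) / 2"
  have p: "p = cis \<theta> * complex_of_real (cmod p) * cis \<phi>"
  proof -
    have "p = complex_of_real (cmod p) * cis (\<theta> + \<phi>)"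
      using rcis_cmod_Arg[of p] by (simp add: rcis_def \<theta>_def \<phi>_def field_simps)
    then show ?thesis by (simp only: cis_mult[symmetric] ac_simps)
  qed
  have q: "q = cis \<theta> * complex_of_real (cmod q) * cnj (cis \<phi>)"
  proof -
    have "q = complex_of_real (cmod q) * cis (\<theta> + - \<phi>)"
      using rcis_cmod_Arg[of q] by (simp add: rcis_def \<theta>_def \<phi>_def field_simps)
    then show ?thesis by (simp only: cis_mult[symmetric] cis_cnj ac_simps)
  qed
  have rotate: "c + p * z + q * cnj z =
      c + cis \<theta> * complex_of_real (cmod p) * (cis \<phi> * z)
        + cis \<theta> * complex_of_real (cmod q) * cnj (cis \<phi> * z)" for z
    by (subst p, subst q) (simp only: complex_cnj_mult mult.assoc)
  have disc: "(*) (cis \<phi>) ` cball 0 1 = cball 0 1"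
  proof (intro equalityI subsetI)
    fix w :: complex
    assume "w \<in> cball 0 1"
    then have "cis (- \<phi>) * w \<in> cball 0 1" by (simp add: norm_mult)
    moreover have "w = cis \<phi> * (cis (- \<phi>) * w)"
      by (simp add: mult.assoc[symmetric] cis_mult)
    ultimately show "w \<in> (*) (cis \<phi>) ` cball 0 1" by blast
  qed (auto simp: norm_mult)
  have "(\<lambda>z. c + p * z + q * cnj z) ` cball 0 1 =
      (\<lambda>w. c + cis \<theta> * complex_of_real (cmod p) * w
             + cis \<theta> * complex_of_real (cmod q) * cnj w) ` ((*) (cis \<phi>) ` cball 0 1)"
    by (simp only: rotate image_image)
  also have "\<dots> = elliptical_disc c \<theta> (cmod p + cmod q) (cmod p - cmod q)"
    unfolding elliptical_disc_eq_image disc by simp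
  finally show ?thesis
    by (simp only: elliptical_disc_abs \<theta>_def)
qed

section \<open>Ellipses under the Levinger map\<close>

text \<open>
  The product of the semi-axes is, up to the factor \<open>\<pi>\<close>, the area, so it scales by the absolute
  value of the determinant \<open>\<alpha> \<beta>\<close> of the Levinger map. This is what keeps non-degenerate ellipses
  non-degenerate.
\<close>

lemma levinger_map_elliptical_disc:
  assumes "a \<ge> 0" "b \<ge> 0"
  obtains \<theta>' a' b' where
    "levinger_map \<alpha> \<beta> ` elliptical_disc c \<theta> a b =
       elliptical_disc (levinger_map \<alpha> \<beta> c) \<theta>' a' b'"
    "a' \<ge> 0" "b' \<ge> 0" "a' * b' = \<bar>\<alpha> * \<beta>\<bar> * (a * b)"
proof -
  define s d where "s = (\<alpha> + \<beta>) / 2" and "d = (\<alpha> - \<beta>) / 2"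
  define m n where "m = (a + b) / 2" and "n = (a - b) / 2"
  define p where "p = complex_of_real (s * m) * cis \<theta> + complex_of_real (d * n) * cnj (cis \<theta>)"
  define q where "q = complex_of_real (s * n) * cis \<theta> + complex_of_real (d * m) * cnj (cis \<theta>)"
  have compose: "levinger_map \<alpha> \<beta>
        (c + cis \<theta> * complex_of_real m * z + cis \<theta> * complex_of_real n * cnj z) =
      levinger_map \<alpha> \<beta> c + p * z + q * cnj z" for z
    unfolding levinger_map_eq s_def[symmetric] d_def[symmetric] p_def q_def
    by (simp add: algebra_simps)
  have image: "levinger_map \<alpha> \<beta> ` elliptical_disc c \<theta> a b =
      elliptical_disc (levinger_map \<alpha> \<beta> c) ((Arg p + Arg q) / 2)
        (cmod p + cmod q) \<bar>cmod p - cmod q\<bar>"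
    unfolding elliptical_disc_eq_image[of c \<theta> a b] m_def[symmetric] n_def[symmetric] image_image compose
    by (rule image_unit_disc_is_elliptical_disc)
  have "(cmod p)\<^sup>2 - (cmod q)\<^sup>2 =
      (s\<^sup>2 - d\<^sup>2) * (m\<^sup>2 - n\<^sup>2) * ((cos \<theta>)\<^sup>2 + (sin \<theta>)\<^sup>2)"
    unfolding cmod_power2 p_def q_def
    by (simp add: power2_eq_square algebra_simps
        del: sin_cos_squared_add sin_cos_squared_add2 sin_cos_squared_add3)
  also have "\<dots> = (\<alpha> * \<beta>) * (a * b)"
    unfolding s_def d_def m_def n_def by (simp add: power2_eq_square field_simps)
  finally have det: "(cmod p)\<^sup>2 - (cmod q)\<^sup>2 = (\<alpha> * \<beta>) * (a * b)" .
  have "(cmod p + cmod q) * \<bar>cmod p - cmod q\<bar> = \<bar>(cmod p)\<^sup>2 - (cmod q)\<^sup>2\<bar>"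
    by (simp add: power2_eq_square square_diff_square_factored abs_mult)
  also have "\<dots> = \<bar>\<alpha> * \<beta>\<bar> * (a * b)"
    using assms by (simp add: det abs_mult)
  finally show ?thesis
    using that[OF image] by simp
qed

lemma is_possibly_degenerate_ellipse_levinger_map:
  assumes "is_possibly_degenerate_ellipse S"
  shows "is_possibly_degenerate_ellipse (levinger_map \<alpha> \<beta> ` S)"
proof -
  obtain c \<theta> a b where "a \<ge> 0" "b \<ge> 0" "S = elliptical_disc c \<theta> a b"
    using assms unfolding is_possibly_degenerate_ellipse_def by blast
  then show ?thesis
    unfolding is_possibly_degenerate_ellipse_def by (metis levinger_map_elliptical_disc)
qed

lemma is_ellipse_levinger_map:
  assumes "is_ellipse S" "\<alpha> \<noteq> 0" "\<beta> \<noteq> 0"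
  shows "is_ellipse (levinger_map \<alpha> \<beta> ` S)"
proof -
  obtain c \<theta> a b where ab: "a > 0" "b > 0" and S: "S = elliptical_disc c \<theta> a b"
    using assms(1) unfolding is_ellipse_def by blast
  obtain \<theta>' a' b' where image:
      "levinger_map \<alpha> \<beta> ` S = elliptical_disc (levinger_map \<alpha> \<beta> c) \<theta>' a' b'"
    and nonneg: "a' \<ge> 0" "b' \<ge> 0" and area: "a' * b' = \<bar>\<alpha> * \<beta>\<bar> * (a * b)"
    using levinger_map_elliptical_disc[of a b \<alpha> \<beta> c \<theta>] ab S by (metis less_imp_le)
  have "a' * b' > 0"
    unfolding area using ab assms(2,3) by simp
  with nonneg have "a' > 0" "b' > 0"
    by (simp_all add: zero_less_mult_iff)
  with image show ?thesis
    unfolding is_ellipse_def by blast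
qed

section \<open>Segments and ellipses in numerical ranges\<close>

theorem proposition1:
  fixes A :: "complex^'n^'n" and B :: "real^'n^'n" and \<alpha> \<beta> :: real
  shows
    "(levinger_map \<alpha> \<beta> ` numerical_range A = numerical_range (levinger A \<alpha> \<beta>) \<and>
      (\<forall>a b. closed_segment a b \<subseteq> numerical_range A \<longrightarrow>
        (\<exists>c d. levinger_map \<alpha> \<beta> ` closed_segment a b = closed_segment c d \<and>
               closed_segment c d \<subseteq> numerical_range (levinger A \<alpha> \<beta>) \<and>
               (a \<noteq> b \<and> \<alpha> \<noteq> 0 \<and> \<beta> \<noteq> 0 \<longrightarrow> c \<noteq> d)))) \<and>
     (\<alpha> \<noteq> 0 \<longrightarrow>
      (is_possibly_degenerate_ellipse (numerical_range (map_matrix complex_of_real B)) \<longrightarrow>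
        is_possibly_degenerate_ellipse
          (numerical_range (levinger (map_matrix complex_of_real B) \<alpha> \<beta>))) \<and>
      (\<beta> \<noteq> 0 \<and> is_ellipse (numerical_range (map_matrix complex_of_real B)) \<longrightarrow>
        is_ellipse (numerical_range (levinger (map_matrix complex_of_real B) \<alpha> \<beta>))))"
proof (intro conjI impI allI)
  show "levinger_map \<alpha> \<beta> ` numerical_range A = numerical_range (levinger A \<alpha> \<beta>)"
    by (simp add: numerical_range_levinger)
next
  fix a b
  assume "closed_segment a b \<subseteq> numerical_range A"
  then have subset: "levinger_map \<alpha> \<beta> ` closed_segment a b \<subseteq> numerical_range (levinger A \<alpha> \<beta>)"
    unfolding numerical_range_levinger by (rule image_mono)
  have image: "levinger_map \<alpha> \<beta> ` closed_segment a b =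
      closed_segment (levinger_map \<alpha> \<beta> a) (levinger_map \<alpha> \<beta> b)"
    by (rule closed_segment_linear_image[OF linear_levinger_map, symmetric])
  have "levinger_map \<alpha> \<beta> a \<noteq> levinger_map \<alpha> \<beta> b" if "a \<noteq> b \<and> \<alpha> \<noteq> 0 \<and> \<beta> \<noteq> 0"
    using that by (auto simp: levinger_map_def complex_eq_iff)
  with subset image show "\<exists>c d. levinger_map \<alpha> \<beta> ` closed_segment a b = closed_segment c d \<and>
      closed_segment c d \<subseteq> numerical_range (levinger A \<alpha> \<beta>) \<and>
      (a \<noteq> b \<and> \<alpha> \<noteq> 0 \<and> \<beta> \<noteq> 0 \<longrightarrow> c \<noteq> d)"
    by metis
next
  assume "is_possibly_degenerate_ellipse (numerical_range (map_matrix complex_of_real B))"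
  then show "is_possibly_degenerate_ellipse
      (numerical_range (levinger (map_matrix complex_of_real B) \<alpha> \<beta>))"
    unfolding numerical_range_levinger by (rule is_possibly_degenerate_ellipse_levinger_map)
next
  assume "\<alpha> \<noteq> 0"
    and "\<beta> \<noteq> 0 \<and> is_ellipse (numerical_range (map_matrix complex_of_real B))"
  then show "is_ellipse (numerical_range (levinger (map_matrix complex_of_real B) \<alpha> \<beta>))"
    unfolding numerical_range_levinger by (blast intro: is_ellipse_levinger_map)
qed

end
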